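(* Let $n \geq 4$. Then \[ a_n(\sigma;123) = \begin{cases} 0 & \text{for } \sigma \in \{123, 312\},\\ 1 & \text{for } \sigma \in \{132, 213, 231, 321\},\end{cases} \qquad a_n(\sigma;132) = \begin{cases} 0 & \text{for } \sigma \in \{123, 231\},\\ 1 & \text{for } \sigma \in \{132, 213, 312, 321\}.\end{cases}\]
   Context: $\mathcal{S}_n$ is the set of permutations of $[n]=\{1,\dots,n\}$, written in one-line notation $\pi=\pi_1\pi_2\cdots\pi_n$ with $\pi_i=\pi(i)$. A permutation is cyclic if it consists of exactly one $n$-cycle. For a cyclic $\pi$, its standard cycle notation is $C(\pi)=(c_1,c_2,\dots,c_n)$ with $c_1=1$ and $c_i=\pi_{c_{i-1}}$ for $2\le i\le n$. A sequence of distinct integers $w_1\cdots w_m$ contains a pattern $\sigma\in\mathcal{S}_k$ if there are indices $i_1<\dots<i_k$ with $w_{i_1}\cdots w_{i_k}$ in the same relative order as $\sigma_1\cdots\sigma_k$; otherwise it avoids $\sigma$. For $\sigma,\tau\in\mathcal{S}_3$, $\mathcal{A}_n(\sigma;\tau)$ is the set of cyclic permutations $\pi\in\mathcal{S}_n$ whose one-line notation avoids $\sigma$ and whose cycle notation $C(\pi)=(c_1,\dots,c_n)$ (as the sequence $c_1c_2\cdots c_n$) avoids $\tau$; $a_n(\sigma;\tau)=|\mathcal{A}_n(\sigma;\tau)|$. *)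

theory Defs
  imports "HOL-Combinatorics.Orbits"
begin

text \<open>
  A permutation of $[n]$ is a function \<open>p :: nat \<Rightarrow> nat\<close> with \<open>p permutes {1..n}\<close>
  (so it is the identity outside \<open>{1..n}\<close>, and distinct functions are distinct permutations).
  Words and patterns are lists, e.g. the pattern 312 is \<open>[3, 1, 2]\<close>. List positions start at 0.
\<close>

definition one_line :: "nat \<Rightarrow> (nat \<Rightarrow> nat) \<Rightarrow> nat list" where
  "one_line n p = map p [1..<Suc n]"

text \<open>
  The recursion \<open>c\<^sub>1 = 1\<close>, \<open>c\<^sub>i = p c\<^sub>i\<^sub>-\<^sub>1\<close> gives \<open>c\<^sub>i = (p ^^ (i - 1)) 1\<close>.
\<close>

definition cycle_notation :: "nat \<Rightarrow> (nat \<Rightarrow> nat) \<Rightarrow> nat list" where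
  "cycle_notation n p = map (\<lambda>i. (p ^^ i) 1) [0..<n]"

text \<open>In the following definition \<open>f\<close> selects the positions \<open>i\<^sub>1 < \<dots> < i\<^sub>k\<close> of an occurrence.\<close>

definition contains_pattern :: "nat list \<Rightarrow> nat list \<Rightarrow> bool" where
  "contains_pattern w s \<longleftrightarrow>
     (\<exists>f. strict_mono_on {..<length s} f \<and> f ` {..<length s} \<subseteq> {..<length w} \<and>
          (\<forall>a<length s. \<forall>b<length s. w ! f a < w ! f b \<longleftrightarrow> s ! a < s ! b))"

definition avoids :: "nat list \<Rightarrow> nat list \<Rightarrow> bool" where
  "avoids w s \<longleftrightarrow> \<not> contains_pattern w s"

definition cyclic_avoiders :: "nat \<Rightarrow> nat list \<Rightarrow> nat list \<Rightarrow> (nat \<Rightarrow> nat) set" where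
  "cyclic_avoiders n s t =
     {p. p permutes {1..n} \<and> cyclic_on p {1..n} \<and>
         avoids (one_line n p) s \<and> avoids (cycle_notation n p) t}"

text \<open>Since \<open>card\<close> is 0 on infinite sets, finiteness matters for reading the count as intended.\<close>

lemma finite_cyclic_avoiders: "finite (cyclic_avoiders n s t)"
  by (rule finite_subset[of _ "{p. p permutes {1..n}}"])
     (auto simp: cyclic_avoiders_def finite_permutations)

definition num_cyclic_avoiders :: "nat \<Rightarrow> nat list \<Rightarrow> nat list \<Rightarrow> nat" where
  "num_cyclic_avoiders n s t = card (cyclic_avoiders n s t)"

end

theory Submission
  imports Defs
begin

text \<open>
  Since the cycle notation starts with its minimum 1, it avoids 123 only if the remaining entries
  decrease, and 132 only if they increase. Either condition determines the cycle, namely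
  $(1,n,n-1,\dots,2)$ and $(1,2,\dots,n)$ with one-line notations $n\,1\,2\cdots(n-1)$ and
  $2\,3\cdots n\,1$, and it remains to see which patterns these two words contain.
\<close>

text \<open>Trades the position function for three indices. Both directions of each comparison are
  listed because entries of \<open>w\<close> or letters of the pattern may coincide, so neither
  direction determines the other.\<close>

lemma contains_pattern_3:
  "contains_pattern w [a, b, c] \<longleftrightarrow>
     (\<exists>i j k. i < j \<and> j < k \<and> k < length w \<and>
        (w ! i < w ! j \<longleftrightarrow> a < b) \<and> (w ! j < w ! i \<longleftrightarrow> b < a) \<and>
        (w ! i < w ! k \<longleftrightarrow> a < c) \<and> (w ! k < w ! i \<longleftrightarrow> c < a) \<and>
        (w ! j < w ! k \<longleftrightarrow> b < c) \<and> (w ! k < w ! j \<longleftrightarrow> c < b))"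
    (is "_ \<longleftrightarrow> ?R")
proof
  assume "contains_pattern w [a, b, c]"
  then obtain f where mono: "strict_mono_on {..<3} f" and ran: "f ` {..<3} \<subseteq> {..<length w}"
    and ord: "\<forall>x<3. \<forall>y<3. w ! f x < w ! f y \<longleftrightarrow> [a, b, c] ! x < [a, b, c] ! y"
    unfolding contains_pattern_def by (auto simp: numeral_3_eq_3)
  have "f 0 < f 1" "f 1 < f 2"
    by (auto intro!: strict_mono_onD[OF mono])
  moreover have "f 2 < length w"
    using ran by (simp add: image_subset_iff)
  moreover have "w ! f 0 < w ! f 1 \<longleftrightarrow> a < b" "w ! f 1 < w ! f 0 \<longleftrightarrow> b < a"
    "w ! f 0 < w ! f 2 \<longleftrightarrow> a < c" "w ! f 2 < w ! f 0 \<longleftrightarrow> c < a"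
    "w ! f 1 < w ! f 2 \<longleftrightarrow> b < c" "w ! f 2 < w ! f 1 \<longleftrightarrow> c < b"
    using ord by simp_all
  ultimately show ?R
    by blast
next
  assume ?R
  then obtain i j k where *: "i < j" "j < k" "k < length w"
    "w ! i < w ! j \<longleftrightarrow> a < b" "w ! j < w ! i \<longleftrightarrow> b < a"
    "w ! i < w ! k \<longleftrightarrow> a < c" "w ! k < w ! i \<longleftrightarrow> c < a"
    "w ! j < w ! k \<longleftrightarrow> b < c" "w ! k < w ! j \<longleftrightarrow> c < b"
    by blast
  \<comment> \<open>Lookup in \<open>[i, j, k]\<close> serves as the position function; only
    arguments below 3 matter.\<close>
  let ?f = "\<lambda>x. [i, j, k] ! x"
  have "strict_mono_on {..<3} ?f" "?f ` {..<3} \<subseteq> {..<length w}"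
    using *(1-3) by (auto simp: strict_mono_on_def numeral_eq_Suc less_Suc_eq)
  moreover have "\<forall>x<3. \<forall>y<3. w ! ?f x < w ! ?f y \<longleftrightarrow> [a, b, c] ! x < [a, b, c] ! y"
    unfolding numeral_3_eq_3 All_less_Suc using *(4-) by simp
  ultimately show "contains_pattern w [a, b, c]"
    unfolding contains_pattern_def by (intro exI[of _ ?f]) (simp add: numeral_3_eq_3)
qed

section \<open>The words of a permutation, and cyclicity in terms of cycle notation\<close>

lemma length_cycle_notation [simp]: "length (cycle_notation n p) = n"
  by (simp add: cycle_notation_def)

lemma nth_cycle_notation [simp]: "i < n \<Longrightarrow> cycle_notation n p ! i = (p ^^ i) 1"
  by (simp add: cycle_notation_def)

lemma length_one_line [simp]: "length (one_line n p) = n"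
  by (simp add: one_line_def)

lemma nth_one_line [simp]: "i < n \<Longrightarrow> one_line n p ! i = p (Suc i)"
  by (simp add: one_line_def del: upt_Suc)

text \<open>The iterates of 1 before its first return enumerate its orbit without repetition. As
  this orbit is \<open>{1..n}\<close>, comparing cardinalities shows that the first return takes
  exactly \<open>n\<close> steps.\<close>

lemma cyclic_on_cycle_notation:
  assumes "cyclic_on p {1..n}" "n \<ge> 1"
  shows set_cycle_notation: "set (cycle_notation n p) = {1..n}"
    and distinct_cycle_notation: "distinct (cycle_notation n p)"
    and funpow_cycle_length: "(p ^^ n) 1 = 1"
proof -
  have orbit: "orbit p 1 = {1..n}"
    using assms by (intro orbit_cyclic_eq3) auto
  then have self: "1 \<in> orbit p 1"
    using assms by simp
  let ?d = "funpow_dist1 p 1 1"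
  have image: "orbit p 1 = (\<lambda>m. (p ^^ m) 1) ` {0..<?d}"
    by (rule orbit_conv_funpow_dist1[OF self])
  have "inj_on (\<lambda>m. (p ^^ m) 1) {0..<?d}"
    by (rule inj_on_funpow_dist1[OF self])
  then have d: "?d = n"
    using image orbit card_image by fastforce
  show set: "set (cycle_notation n p) = {1..n}"
    using image orbit unfolding d cycle_notation_def by simp
  show "distinct (cycle_notation n p)"
    by (rule card_distinct) (simp add: set)
  show "(p ^^ n) 1 = 1"
    using funpow_dist1_prop[OF self] unfolding d .
qed

lemma cyclic_onI_cycle_notation:
  assumes "p permutes {1..n}" "set (cycle_notation n p) = {1..n}" "n \<ge> 1"
  shows "cyclic_on p {1..n}"
proof -
  \<comment> \<open>\<open>orbit\<close> is generated from \<open>p 1\<close>, not from 1; for a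
    permutation of finite support the zeroth iterate belongs to it as well.\<close>
  have "permutation p"
    using assms(1) permutation_permutes by blast
  then have "orbit p 1 = {(p ^^ m) 1 |m. True}"
    by (rule orbit_altdef_permutation)
  then have "set (cycle_notation n p) \<subseteq> orbit p 1"
    by (auto simp: cycle_notation_def)
  moreover have "orbit p 1 \<subseteq> {1..n}"
    using assms by (intro permutes_orbit_subset) auto
  ultimately have "orbit p 1 = {1..n}"
    using assms(2) by blast
  then show ?thesis
    using assms(3) unfolding cyclic_on_def by force
qed

text \<open>Every point of the cycle is an entry of the word, and its image is the next entry, or 1
  after the last one.\<close>

lemma cycle_notation_inject:
  assumes "p permutes {1..n}" "cyclic_on p {1..n}" "q permutes {1..n}" "cyclic_on q {1..n}"
    and eq: "cycle_notation n p = cycle_notation n q"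
  shows "p = q"
proof
  fix x
  show "p x = q x"
  proof (cases "x \<in> {1..n}")
    case False
    then show ?thesis
      using assms by (simp add: permutes_not_in)
  next
    case True
    then have n: "n \<ge> 1"
      by simp
    \<comment> \<open>The case \<open>i = n\<close> is needed for the image of the last entry, which
      lies past the end of the word; there both iterates have returned to 1.\<close>
    have funpow: "(p ^^ i) 1 = (q ^^ i) 1" if "i \<le> n" for i
    proof (cases "i = n")
      case True
      then show ?thesis
        using funpow_cycle_length assms n by metis
    next
      case False
      then show ?thesis
        using that arg_cong[OF eq, of "\<lambda>w. w ! i"] by simp
    qed
    have "x \<in> set (cycle_notation n p)"
      unfolding set_cycle_notation[OF assms(2) n] by (rule True)
    then obtain i where i: "i < n" "x = (p ^^ i) 1"
      by (auto simp: cycle_notation_def)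
    then have "p x = (p ^^ Suc i) 1"
      by simp
    also have "\<dots> = (q ^^ Suc i) 1"
      using i by (intro funpow) simp
    also have "\<dots> = q x"
      using i funpow[of i] by simp
    finally show ?thesis .
  qed
qed

section \<open>The two candidate cycles\<close>

definition up_cycle :: "nat \<Rightarrow> nat \<Rightarrow> nat" where
  "up_cycle n x = (if x \<in> {1..n} then if x = n then 1 else x + 1 else x)"

text \<open>The inverse of \<open>up_cycle n\<close>; each of the two witnesses the bijectivity of
  the other.\<close>

definition down_cycle :: "nat \<Rightarrow> nat \<Rightarrow> nat" where
  "down_cycle n x = (if x \<in> {1..n} then if x = 1 then n else x - 1 else x)"

lemma up_cycle_permutes: "up_cycle n permutes {1..n}"
  by (rule bij_imp_permutes[OF bij_betw_byWitness[where f' = "down_cycle n"]])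
     (auto simp: up_cycle_def down_cycle_def)

lemma down_cycle_permutes: "down_cycle n permutes {1..n}"
  by (rule bij_imp_permutes[OF bij_betw_byWitness[where f' = "up_cycle n"]])
     (auto simp: up_cycle_def down_cycle_def)

lemma funpow_up_cycle: "i < n \<Longrightarrow> (up_cycle n ^^ i) (Suc 0) = Suc i"
  by (induction i) (auto simp: up_cycle_def)

text \<open>The case split is there because \<open>Suc n - i\<close> would give \<open>n + 1\<close>
  instead of 1 at \<open>i = 0\<close>.\<close>

lemma funpow_down_cycle: "i < n \<Longrightarrow> (down_cycle n ^^ i) (Suc 0) = (if i = 0 then 1 else Suc n - i)"
  by (induction i) (auto simp: down_cycle_def)

lemma cycle_notation_up_cycle: "cycle_notation n (up_cycle n) = [1..<Suc n]"
  by (rule nth_equalityI) (simp_all add: funpow_up_cycle del: upt_Suc)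

lemma cycle_notation_down_cycle:
  "n \<ge> 1 \<Longrightarrow> cycle_notation n (down_cycle n) = 1 # rev [2..<Suc n]"
  by (rule nth_equalityI) (auto simp: funpow_down_cycle rev_nth nth_Cons' simp del: upt_Suc)

lemma cyclic_up_cycle: "n \<ge> 1 \<Longrightarrow> cyclic_on (up_cycle n) {1..n}"
  by (rule cyclic_onI_cycle_notation)
     (auto simp: up_cycle_permutes[simplified] cycle_notation_up_cycle)

lemma cyclic_down_cycle: "n \<ge> 1 \<Longrightarrow> cyclic_on (down_cycle n) {1..n}"
  by (rule cyclic_onI_cycle_notation)
     (auto simp: down_cycle_permutes[simplified] cycle_notation_down_cycle)

section \<open>Avoidance in cycle notation determines the cycle\<close>

lemma strict_sorted_eq_upt:
  assumes "sorted_wrt (<) xs" "set xs = {m..<n}"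
  shows "xs = [m..<n]"
  using assms by (intro strict_sorted_equal) auto

text \<open>The leading minimum plays the letter 1, so any wrongly ordered pair in \<open>v\<close>
  would complete an occurrence. Distinctness turns a failed strict comparison into the opposite
  strict one.\<close>

lemma avoids_after_min:
  assumes "avoids (m # v) s" "distinct (m # v)" "\<forall>x\<in>set v. m < x"
  shows avoids_123_after_min: "s = [1, 2, 3] \<Longrightarrow> sorted_wrt (>) v"
    and avoids_132_after_min: "s = [1, 3, 2] \<Longrightarrow> sorted_wrt (<) v"
proof -
  have *: "v ! j \<noteq> v ! k \<and> m < v ! j \<and> m < v ! k" if "j < k" "k < length v" for j k
    using that assms by (auto simp: nth_eq_iff_index_eq)
  show "sorted_wrt (>) v" if "s = [1, 2, 3]"
    unfolding sorted_wrt_iff_nth_less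
  proof (intro allI impI, rule ccontr)
    fix j k assume jk: "j < k" "k < length v" "\<not> v ! j > v ! k"
    then have "contains_pattern (m # v) s"
      unfolding that contains_pattern_3
      using *[of j k] by (intro exI[of _ 0] exI[of _ "Suc j"] exI[of _ "Suc k"]) auto
    then show False
      using assms(1) by (simp add: avoids_def)
  qed
  show "sorted_wrt (<) v" if "s = [1, 3, 2]"
    unfolding sorted_wrt_iff_nth_less
  proof (intro allI impI, rule ccontr)
    fix j k assume jk: "j < k" "k < length v" "\<not> v ! j < v ! k"
    then have "contains_pattern (m # v) s"
      unfolding that contains_pattern_3
      using *[of j k] by (intro exI[of _ 0] exI[of _ "Suc j"] exI[of _ "Suc k"]) auto
    then show False
      using assms(1) by (simp add: avoids_def)
  qed
qed

lemma cycle_notation_Cons: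
  assumes "cyclic_on p {1..n}" "n \<ge> 1"
  obtains v where "cycle_notation n p = 1 # v" "distinct (1 # v)" "set v = {2..<Suc n}"
proof -
  obtain v where v: "cycle_notation n p = 1 # v"
    using assms(2) by (auto simp: cycle_notation_def upt_conv_Cons)
  moreover have distinct: "distinct (1 # v)"
    using distinct_cycle_notation[OF assms] v by simp
  moreover have "insert 1 (set v) = {1..n}"
    using set_cycle_notation[OF assms] v by simp
  then have "set v = {1..n} - {1}"
    using distinct by auto
  moreover have "{1..n} - {1} = {2..<Suc n}"
    by auto
  ultimately show thesis
    using that by simp
qed

lemma cyclic_avoids_132_iff:
  assumes "n \<ge> 1"
  shows "p permutes {1..n} \<and> cyclic_on p {1..n} \<and> avoids (cycle_notation n p) [1, 3, 2]
    \<longleftrightarrow> p = up_cycle n"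
proof
  assume p: "p permutes {1..n} \<and> cyclic_on p {1..n} \<and> avoids (cycle_notation n p) [1, 3, 2]"
  then obtain v where v: "cycle_notation n p = 1 # v" "distinct (1 # v)" "set v = {2..<Suc n}"
    using cycle_notation_Cons assms by metis
  then have "sorted_wrt (<) v"
    using p by (intro avoids_132_after_min[of 1 v]) auto
  then have "cycle_notation n p = cycle_notation n (up_cycle n)"
    using strict_sorted_eq_upt v assms
    by (simp add: cycle_notation_up_cycle upt_conv_Cons numeral_2_eq_2 del: upt_Suc)
  then show "p = up_cycle n"
    using cycle_notation_inject p up_cycle_permutes cyclic_up_cycle[OF assms] by blast
next
  assume "p = up_cycle n"
  then show "p permutes {1..n} \<and> cyclic_on p {1..n} \<and> avoids (cycle_notation n p) [1, 3, 2]"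
    using up_cycle_permutes cyclic_up_cycle[OF assms]
    \<comment> \<open>The entry at position \<open>i\<close> is \<open>Suc i\<close>, so there is no
      descent to play 3 and 2.\<close>
    by (auto simp: avoids_def contains_pattern_3 funpow_up_cycle)
qed

lemma cyclic_avoids_123_iff:
  assumes "n \<ge> 1"
  shows "p permutes {1..n} \<and> cyclic_on p {1..n} \<and> avoids (cycle_notation n p) [1, 2, 3]
    \<longleftrightarrow> p = down_cycle n"
proof
  assume p: "p permutes {1..n} \<and> cyclic_on p {1..n} \<and> avoids (cycle_notation n p) [1, 2, 3]"
  then obtain v where v: "cycle_notation n p = 1 # v" "distinct (1 # v)" "set v = {2..<Suc n}"
    using cycle_notation_Cons assms by metis
  then have "sorted_wrt (>) v"
    using p by (intro avoids_123_after_min[of 1 v]) auto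
  \<comment> \<open>Reversal makes the decreasing tail increasing, so that its set determines
    it.\<close>
  then have "rev v = [2..<Suc n]"
    using v by (intro strict_sorted_eq_upt) (auto simp: sorted_wrt_rev)
  then have "cycle_notation n p = cycle_notation n (down_cycle n)"
    using v assms by (simp add: cycle_notation_down_cycle rev_swap del: upt_Suc)
  then show "p = down_cycle n"
    using cycle_notation_inject p down_cycle_permutes cyclic_down_cycle[OF assms] by blast
next
  assume "p = down_cycle n"
  then show "p permutes {1..n} \<and> cyclic_on p {1..n} \<and> avoids (cycle_notation n p) [1, 2, 3]"
    using down_cycle_permutes cyclic_down_cycle[OF assms]
    \<comment> \<open>The letters 2 and 3 would sit at positive positions, where the entries
      decrease.\<close>
    by (auto simp: avoids_def contains_pattern_3 funpow_down_cycle)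
qed

section \<open>Counting, and the patterns in the two one-line words\<close>

lemma num_cyclic_avoiders_132:
  assumes "n \<ge> 1"
  shows "num_cyclic_avoiders n s [1, 3, 2] = (if avoids (one_line n (up_cycle n)) s then 1 else 0)"
proof -
  have "cyclic_avoiders n s [1, 3, 2] = {p. p = up_cycle n \<and> avoids (one_line n p) s}"
    using cyclic_avoids_132_iff[OF assms] unfolding cyclic_avoiders_def by blast
  then show ?thesis
    by (simp add: num_cyclic_avoiders_def Collect_conv_if)
qed

lemma num_cyclic_avoiders_123:
  assumes "n \<ge> 1"
  shows "num_cyclic_avoiders n s [1, 2, 3] = (if avoids (one_line n (down_cycle n)) s then 1 else 0)"
proof -
  have "cyclic_avoiders n s [1, 2, 3] = {p. p = down_cycle n \<and> avoids (one_line n p) s}"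
    using cyclic_avoids_123_iff[OF assms] unfolding cyclic_avoiders_def by blast
  then show ?thesis
    by (simp add: num_cyclic_avoiders_def Collect_conv_if)
qed

lemma avoids_one_line_down_cycle:
  "\<forall>s \<in> {[1,3,2], [2,1,3], [2,3,1], [3,2,1]}. avoids (one_line n (down_cycle n)) s"
  by (auto simp: avoids_def contains_pattern_3 down_cycle_def split: if_splits)

lemma avoids_one_line_up_cycle:
  "\<forall>s \<in> {[1,3,2], [2,1,3], [3,1,2], [3,2,1]}. avoids (one_line n (up_cycle n)) s"
  by (auto simp: avoids_def contains_pattern_3 up_cycle_def split: if_splits)

lemma not_avoids_one_line_down_cycle:
  assumes "n \<ge> 4"
  shows "\<not> avoids (one_line n (down_cycle n)) [1, 2, 3]"
    and "\<not> avoids (one_line n (down_cycle n)) [3, 1, 2]"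
proof -
  show "\<not> avoids (one_line n (down_cycle n)) [1, 2, 3]"
    unfolding avoids_def not_not contains_pattern_3
    \<comment> \<open>These positions hold 1, 2, 3; the last one exists because \<open>n\<close> is
      at least 4.\<close>
    using assms by (intro exI[of _ 1] exI[of _ 2] exI[of _ 3]) (simp add: down_cycle_def)
  show "\<not> avoids (one_line n (down_cycle n)) [3, 1, 2]"
    unfolding avoids_def not_not contains_pattern_3
    using assms by (intro exI[of _ 0] exI[of _ 1] exI[of _ 2]) (simp add: down_cycle_def)
qed

lemma not_avoids_one_line_up_cycle:
  assumes "n \<ge> 4"
  shows "\<not> avoids (one_line n (up_cycle n)) [1, 2, 3]"
    and "\<not> avoids (one_line n (up_cycle n)) [2, 3, 1]"
proof -
  show "\<not> avoids (one_line n (up_cycle n)) [1, 2, 3]"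
    unfolding avoids_def not_not contains_pattern_3
    \<comment> \<open>The entries are 2, 3, 4; for \<open>n = 3\<close> the third would already be
      the final 1.\<close>
    using assms by (intro exI[of _ 0] exI[of _ 1] exI[of _ 2]) (simp add: up_cycle_def)
  show "\<not> avoids (one_line n (up_cycle n)) [2, 3, 1]"
    unfolding avoids_def not_not contains_pattern_3
    \<comment> \<open>The last position supplies the entry 1 after 2 and 3.\<close>
    using assms by (intro exI[of _ 0] exI[of _ 1] exI[of _ "n - 1"]) (simp add: up_cycle_def)
qed

theorem theorem2p1:
  fixes n :: nat
  assumes "n \<ge> 4"
  shows "(\<forall>\<sigma> \<in> {[1,2,3], [3,1,2]}. num_cyclic_avoiders n \<sigma> [1,2,3] = 0) \<and>
         (\<forall>\<sigma> \<in> {[1,3,2], [2,1,3], [2,3,1], [3,2,1]}. num_cyclic_avoiders n \<sigma> [1,2,3] = 1) \<and>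
         (\<forall>\<sigma> \<in> {[1,2,3], [2,3,1]}. num_cyclic_avoiders n \<sigma> [1,3,2] = 0) \<and>
         (\<forall>\<sigma> \<in> {[1,3,2], [2,1,3], [3,1,2], [3,2,1]}. num_cyclic_avoiders n \<sigma> [1,3,2] = 1)"
proof -
  have "n \<ge> 1"
    using assms by simp
  then show ?thesis
    using num_cyclic_avoiders_123 num_cyclic_avoiders_132
      avoids_one_line_down_cycle[of n] avoids_one_line_up_cycle[of n]
      not_avoids_one_line_down_cycle[OF assms] not_avoids_one_line_up_cycle[OF assms]
    by simp
qed

end
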